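(* Let $U$ be a set and $\mathcal R$ a set of partial bijections on $U$ that is closed under composition and inverse and such that $\mathrm{id}_{\{u\}}\in\mathcal R$ for every $u\in U$. Then for every first-order formula $A$ of the language of the structure $(U,\mathcal R)$ there is a quantifier-free formula $C$ containing no constant symbols that is equivalent to $A$ in $(U,\mathcal R)$.
   Context: A partial bijection on $U$ is a relation $R\subseteq U\times U$ which is a one-to-one correspondence between a subset of $U$ and a subset of $U$. For relations, $R^{-1}=\{(y,x)\mid (x,y)\in R\}$, $R\circ S=\{(x,z)\mid\exists y.\,(x,y)\in S\wedge(y,z)\in R\}$, and $\mathrm{id}_X=\{(x,x)\mid x\in X\}$. $\mathcal R$ is closed under composition and inverse if $R,S\in\mathcal R$ implies $R^{-1}\in\mathcal R$ and $R\circ S\in\mathcal R$. The structure $(U,\mathcal R)$ has universe $U$, a binary predicate symbol for each $R\in\mathcal R$, a constant symbol for each $u\in U$, and equality; "equivalent" means $A\leftrightarrow C$ holds in $(U,\mathcal R)$ under every assignment of the variables. *)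

theory Defs
  imports Main
begin

definition partial_bijection_on :: "'a set \<Rightarrow> 'a rel \<Rightarrow> bool" where
  "partial_bijection_on U R \<longleftrightarrow>
     R \<subseteq> U \<times> U \<and>
     (\<exists>X Y f. X \<subseteq> U \<and> Y \<subseteq> U \<and> bij_betw f X Y \<and> R = {(x, f x) | x. x \<in> X})"

text \<open>
  The paper composes relations from right to left, whereas the library's \<open>O\<close> composes from
  left to right; hence \<open>S O R\<close> for the composition of \<open>R\<close> after \<open>S\<close>.
\<close>

definition closed_comp_inv :: "'a rel set \<Rightarrow> bool" where
  "closed_comp_inv \<R> \<longleftrightarrow> (\<forall>R\<in>\<R>. \<forall>S\<in>\<R>. R\<inverse> \<in> \<R> \<and> S O R \<in> \<R>)"

datatype (tm_consts: 'c) tm = Var nat | Const 'c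

datatype (fm_consts: 'c, fm_preds: 'p) fm =
    Fls
  | Eq "'c tm" "'c tm"
  | Pred 'p "'c tm" "'c tm"
  | Neg "('c, 'p) fm"
  | Conj "('c, 'p) fm" "('c, 'p) fm"
  | Disj "('c, 'p) fm" "('c, 'p) fm"
  | Imp "('c, 'p) fm" "('c, 'p) fm"
  | Iff "('c, 'p) fm" "('c, 'p) fm"
  | Ex nat "('c, 'p) fm"
  | All nat "('c, 'p) fm"

text \<open>
  In the language of \<open>(U, \<R>)\<close> each element of \<open>U\<close> serves as its own constant symbol and each
  relation in \<open>\<R>\<close> as its own binary predicate symbol. Variables are named by natural numbers.
\<close>

type_synonym 'a formula = "('a, 'a rel) fm"

definition in_language :: "'a set \<Rightarrow> 'a rel set \<Rightarrow> 'a formula \<Rightarrow> bool" where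
  "in_language U \<R> A \<longleftrightarrow> fm_consts A \<subseteq> U \<and> fm_preds A \<subseteq> \<R>"

primrec quantifier_free :: "('c, 'p) fm \<Rightarrow> bool" where
  "quantifier_free Fls \<longleftrightarrow> True"
| "quantifier_free (Eq s t) \<longleftrightarrow> True"
| "quantifier_free (Pred R s t) \<longleftrightarrow> True"
| "quantifier_free (Neg A) \<longleftrightarrow> quantifier_free A"
| "quantifier_free (Conj A B) \<longleftrightarrow> quantifier_free A \<and> quantifier_free B"
| "quantifier_free (Disj A B) \<longleftrightarrow> quantifier_free A \<and> quantifier_free B"
| "quantifier_free (Imp A B) \<longleftrightarrow> quantifier_free A \<and> quantifier_free B"
| "quantifier_free (Iff A B) \<longleftrightarrow> quantifier_free A \<and> quantifier_free B"
| "quantifier_free (Ex x A) \<longleftrightarrow> False"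
| "quantifier_free (All x A) \<longleftrightarrow> False"

primrec tm_val :: "(nat \<Rightarrow> 'a) \<Rightarrow> 'a tm \<Rightarrow> 'a" where
  "tm_val e (Var x) = e x"
| "tm_val e (Const u) = u"

primrec sat :: "'a set \<Rightarrow> (nat \<Rightarrow> 'a) \<Rightarrow> 'a formula \<Rightarrow> bool" where
  "sat U e Fls \<longleftrightarrow> False"
| "sat U e (Eq s t) \<longleftrightarrow> tm_val e s = tm_val e t"
| "sat U e (Pred R s t) \<longleftrightarrow> (tm_val e s, tm_val e t) \<in> R"
| "sat U e (Neg A) \<longleftrightarrow> \<not> sat U e A"
| "sat U e (Conj A B) \<longleftrightarrow> sat U e A \<and> sat U e B"
| "sat U e (Disj A B) \<longleftrightarrow> sat U e A \<or> sat U e B"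
| "sat U e (Imp A B) \<longleftrightarrow> (sat U e A \<longrightarrow> sat U e B)"
| "sat U e (Iff A B) \<longleftrightarrow> (sat U e A \<longleftrightarrow> sat U e B)"
| "sat U e (Ex x A) \<longleftrightarrow> (\<exists>u\<in>U. sat U (e(x := u)) A)"
| "sat U e (All x A) \<longleftrightarrow> (\<forall>u\<in>U. sat U (e(x := u)) A)"

definition equivalent_in :: "'a set \<Rightarrow> 'a formula \<Rightarrow> 'a formula \<Rightarrow> bool" where
  "equivalent_in U A C \<longleftrightarrow> (\<forall>e. (\<forall>x. e x \<in> U) \<longrightarrow> sat U e (Iff A C))"

end

(*
  The graphs of partial bijections give a language in which a variable x is either tied to another
  variable y by some (y, x) in R, in which case x can be eliminated by composing R with the other
  relations, or is subject only to a condition "x in S" and to finitely many negative conditions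
  "(y, x) not in R". Each negative condition excludes at most one value of x, so they can be
  satisfied whenever S is infinite; when S is finite, one tries its elements, and
  "(y, u) in R" for a fixed u is the constant-free atom "(y, y) in R O id_{u} O R^-1" (composed from left to right).
*)
theory Submission
  imports Defs
begin

section \<open>Predicates definable over a closed family of partial bijections\<close>

lemma partial_bijection_onD:
  assumes "partial_bijection_on U R"
  shows "R \<subseteq> U \<times> U" "single_valued R"
  using assms by (auto simp: partial_bijection_on_def single_valued_def)

text \<open>Injectivity of a member is the single-valuedness of its inverse, which is again a
  member.\<close>

locale partial_bijections =
  fixes U :: "'a set" and \<Q> :: "'a rel set"
  assumes sub: "R \<in> \<Q> \<Longrightarrow> R \<subseteq> U \<times> U"
    and sv: "R \<in> \<Q> \<Longrightarrow> single_valued R"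
    and inv: "R \<in> \<Q> \<Longrightarrow> R\<inverse> \<in> \<Q>"
    and comp: "R \<in> \<Q> \<Longrightarrow> S \<in> \<Q> \<Longrightarrow> R O S \<in> \<Q>"
    and pt: "u \<in> U \<Longrightarrow> Id_on {u} \<in> \<Q>"
    and idU: "Id_on U \<in> \<Q>"
begin

text \<open>Working with predicates instead of formulas lets equivalent conditions be exchanged as
  equal functions. Assignments are arbitrary here; they are confined to \<open>U\<close> only in the
  passage from and to formulas.\<close>

inductive qf :: "((nat \<Rightarrow> 'a) \<Rightarrow> bool) \<Rightarrow> bool" where
  atom: "R \<in> \<Q> \<Longrightarrow> qf (\<lambda>e. (e y, e z) \<in> R)"
| neg: "qf P \<Longrightarrow> qf (\<lambda>e. \<not> P e)"
| conj: "qf P \<Longrightarrow> qf P' \<Longrightarrow> qf (\<lambda>e. P e \<and> P' e)"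

lemma qf_disj: "qf P \<Longrightarrow> qf P' \<Longrightarrow> qf (\<lambda>e. P e \<or> P' e)"
  using neg[OF conj[OF neg[of P] neg[of P']]] by simp

lemma qf_imp: "qf P \<Longrightarrow> qf P' \<Longrightarrow> qf (\<lambda>e. P e \<longrightarrow> P' e)"
  unfolding imp_conv_disj by (intro qf_disj neg)

lemma qf_iff: "qf P \<Longrightarrow> qf P' \<Longrightarrow> qf (\<lambda>e. P e \<longleftrightarrow> P' e)"
  unfolding iff_conv_conj_imp by (intro conj qf_imp)

lemma qf_const: "qf (\<lambda>e. b)"
proof -
  \<comment> \<open>This atom may fail when \<open>e 0\<close> lies outside \<open>U\<close>, so
    truth is expressed as its disjunction with its negation, and falsity as the conjunction of the
    two.\<close>
  have a: "qf (\<lambda>e. (e 0, e 0) \<in> Id_on U)" by (rule atom[OF idU])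
  show ?thesis using conj[OF a neg[OF a]] qf_disj[OF a neg[OF a]] by (cases b) auto
qed

lemma qf_Bex: "finite I \<Longrightarrow> (\<And>i. i \<in> I \<Longrightarrow> qf (P i)) \<Longrightarrow> qf (\<lambda>e. \<exists>i\<in>I. P i e)"
  by (induction I rule: finite_induct) (auto intro: qf_const qf_disj)

lemma qf_Ball: "finite I \<Longrightarrow> (\<And>i. i \<in> I \<Longrightarrow> qf (P i)) \<Longrightarrow> qf (\<lambda>e. \<forall>i\<in>I. P i e)"
  by (induction I rule: finite_induct) (auto intro: qf_const conj)

lemma qf_atom_const:
  assumes "R \<in> \<Q>" "u \<in> U"
  shows "qf (\<lambda>e. (e y, u) \<in> R)"
proof -
  have "qf (\<lambda>e. (e y, e y) \<in> R O Id_on {u} O R\<inverse>)"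
    using assms by (intro atom comp inv pt)
  moreover have "(\<lambda>e. (e y, e y) \<in> R O Id_on {u} O R\<inverse>) = (\<lambda>e. (e y, u) \<in> R)"
    by auto
  ultimately show ?thesis by simp
qed

lemma qf_const_atom: "R \<in> \<Q> \<Longrightarrow> u \<in> U \<Longrightarrow> qf (\<lambda>e. (u, e y) \<in> R)"
  using qf_atom_const[of "R\<inverse>" u y] by (simp add: inv)

text \<open>A step along \<open>R\<close> can be retraced by \<open>R\<inverse>\<close>, so the loop
  at \<open>e y\<close> exists exactly when the first step does.\<close>

lemma qf_dom:
  assumes "R \<in> \<Q>"
  shows "qf (\<lambda>e. \<exists>u. (e y, u) \<in> R)"
proof -
  have "(\<lambda>e. \<exists>u. (e y, u) \<in> R) = (\<lambda>e. (e y, e y) \<in> R O R\<inverse>)"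
    by auto
  then show ?thesis using atom[of "R O R\<inverse>" y y] assms comp inv by simp
qed

text \<open>Since \<open>R\<close> is single-valued, there is at most one candidate
  \<open>u\<close>. The quantifier therefore commutes with conjunction, and with negation once the
  existence of a candidate is asserted separately.\<close>

lemma qf_subst:
  assumes "qf P" "R \<in> \<Q>"
  shows "qf (\<lambda>e. \<exists>u. (e y, u) \<in> R \<and> P (e(x := u)))"
  using assms(1)
proof induction
  case (atom S z w)
  \<comment> \<open>One predicate for each way in which \<open>x\<close> can occur in the atom: on
    both sides, only on the left, only on the right, or not at all.\<close>
  have 1: "qf (\<lambda>e. (e y, e y) \<in> R O S O R\<inverse>)" "qf (\<lambda>e. (e y, e w) \<in> R O S)"
    "qf (\<lambda>e. (e z, e y) \<in> S O R\<inverse>)" "qf (\<lambda>e. (\<exists>u. (e y, u) \<in> R) \<and> (e z, e w) \<in> S)"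
    by (intro qf.conj qf_dom qf.atom comp inv atom assms(2))+
  have 2: "(\<lambda>e. (e y, e y) \<in> R O S O R\<inverse>) = (\<lambda>e. \<exists>u. (e y, u) \<in> R \<and> (u, u) \<in> S)"
  proof (intro ext iffI)
    fix e
    assume "(e y, e y) \<in> R O S O R\<inverse>"
    then obtain u v where "(e y, u) \<in> R" "(u, v) \<in> S" "(e y, v) \<in> R" by auto
    moreover from this have "u = v" using single_valuedD[OF sv[OF assms(2)]] by metis
    ultimately show "\<exists>u. (e y, u) \<in> R \<and> (u, u) \<in> S" by auto
  qed auto
  have 3: "(\<lambda>e. (e y, e w) \<in> R O S) = (\<lambda>e. \<exists>u. (e y, u) \<in> R \<and> (u, e w) \<in> S)"
    "(\<lambda>e. (e z, e y) \<in> S O R\<inverse>) = (\<lambda>e. \<exists>u. (e y, u) \<in> R \<and> (e z, u) \<in> S)"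
    by (auto simp: fun_eq_iff)
  show ?case
    using 1 unfolding 2 3 by (cases "z = x"; cases "w = x") simp_all
next
  case (neg P)
  have "(\<lambda>e. \<exists>u. (e y, u) \<in> R \<and> \<not> P (e(x := u))) =
      (\<lambda>e. (\<exists>u. (e y, u) \<in> R) \<and> \<not> (\<exists>u. (e y, u) \<in> R \<and> P (e(x := u))))"
    using sv[OF assms(2)] by (auto simp: fun_eq_iff single_valued_def)
  with qf.conj[OF qf_dom[OF assms(2), of y] qf.neg[OF neg.IH]] show ?case by (simp only:)
next
  case (conj P P')
  have "(\<lambda>e. \<exists>u. (e y, u) \<in> R \<and> P (e(x := u)) \<and> P' (e(x := u))) =
      (\<lambda>e. (\<exists>u. (e y, u) \<in> R \<and> P (e(x := u))) \<and> (\<exists>u. (e y, u) \<in> R \<and> P' (e(x := u))))"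
    using sv[OF assms(2)] by (auto simp: fun_eq_iff single_valued_def)
  with qf.conj[OF conj.IH] show ?case by (simp only:)
qed

section \<open>Eliminating a quantifier from a basic condition\<close>

text \<open>
  In the second rule \<open>S\<close> may be any set, so that the complement of a condition on \<open>x\<close> alone is again
  of this form; the last premise is therefore not implied by the others.
\<close>

inductive basic :: "nat \<Rightarrow> ((nat \<Rightarrow> 'a) \<Rightarrow> bool) \<Rightarrow> bool" for x where
  tied: "y \<noteq> x \<Longrightarrow> R \<in> \<Q> \<Longrightarrow> qf P \<Longrightarrow> basic x (\<lambda>e. (e y, e x) \<in> R \<and> P e)"
| loose: "qf P \<Longrightarrow> (\<And>e u. P (e(x := u)) = P e) \<Longrightarrow> finite T \<Longrightarrow>
    T \<subseteq> (- {x}) \<times> \<Q> \<Longrightarrow>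
    qf (\<lambda>e. P e \<and> e x \<in> S \<and> (\<forall>(y, R)\<in>T. (e y, e x) \<notin> R)) \<Longrightarrow>
    basic x (\<lambda>e. P e \<and> e x \<in> S \<and> (\<forall>(y, R)\<in>T. (e y, e x) \<notin> R))"

lemma basic_qf: "basic x P \<Longrightarrow> qf P"
  by (erule basic.cases) (simp_all add: conj atom)

text \<open>A tie in either conjunct absorbs the other conjunct into its remaining condition. Two
  loose conditions merge by intersecting the sets \<open>S\<close> and uniting the
  exclusions.\<close>

lemma basic_conj:
  assumes "basic x P" "basic x P'"
  shows "basic x (\<lambda>e. P e \<and> P' e)"
  using assms(1)
proof cases
  case (tied y R B)
  then show ?thesis
    using basic.tied[of y x R "\<lambda>e. B e \<and> P' e"] conj basic_qf[OF assms(2)] by simp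
next
  case l: (loose B T S)
  show ?thesis
    using assms(2)
  proof cases
    case (tied y R B)
    then show ?thesis
      using basic.tied[of y x R "\<lambda>e. P e \<and> B e"] conj basic_qf[OF assms(1)]
      by (simp add: conj_ac)
  next
    case l': (loose B' T' S')
    have eq: "(\<lambda>e. P e \<and> P' e) = (\<lambda>e. (B e \<and> B' e) \<and> e x \<in> S \<inter> S' \<and>
        (\<forall>(y, R)\<in>T \<union> T'. (e y, e x) \<notin> R))"
      by (simp add: l(1) l'(1) ball_Un conj_ac)
    have "qf (\<lambda>e. P e \<and> P' e)"
      using assms by (intro conj basic_qf)
    then show ?thesis
      unfolding eq using l l' by (intro loose) (auto intro: conj)
  qed
qed

lemma qf_ex_basic:
  assumes "basic x P"
  shows "qf (\<lambda>e. \<exists>u\<in>U. P (e(x := u)))"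
  using assms
proof cases
  case (tied y R B)
  \<comment> \<open>The bound \<open>u \<in> U\<close> is automatic, as \<open>R\<close> takes
    values in \<open>U\<close>.\<close>
  have "(\<lambda>e. \<exists>u\<in>U. P (e(x := u))) = (\<lambda>e. \<exists>u. (e y, u) \<in> R \<and> B (e(x := u)))"
    using tied sub[of R] by (auto simp: fun_eq_iff)
  with qf_subst tied show ?thesis by simp
next
  case (loose B T S)
  have *: "(\<exists>u\<in>U. P (e(x := u))) \<longleftrightarrow> B e \<and> (\<exists>u\<in>U \<inter> S. \<forall>(y, R)\<in>T. (e y, u) \<notin> R)" for e
  proof -
    \<comment> \<open>The variables \<open>y\<close> in \<open>T\<close> differ from
      \<open>x\<close>, so the update leaves their values alone.\<close>
    have "(\<forall>(y, R)\<in>T. ((e(x := u)) y, (e(x := u)) x) \<notin> R) \<longleftrightarrow> (\<forall>(y, R)\<in>T. (e y, u) \<notin> R)" for u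
      using subsetD[OF loose(5)] by (intro ball_cong refl) auto
    then show ?thesis unfolding loose(1) loose(3) by auto
  qed
  show ?thesis
  proof (cases "finite (U \<inter> S)")
    case True
    have "qf (\<lambda>e. \<exists>u\<in>U \<inter> S. \<forall>i\<in>T. \<not> (e (fst i), u) \<in> snd i)"
      using True loose by (intro qf_Bex qf_Ball neg qf_atom_const) auto
    with loose(2) show ?thesis
      unfolding * by (intro conj) (simp_all add: case_prod_unfold)
  next
    case False
    have "\<exists>u\<in>U \<inter> S. \<forall>(y, R)\<in>T. (e y, u) \<notin> R" for e
    proof -
      have "finite (R `` {e y})" if "(y, R) \<in> T" for y R
      proof -
        have "single_valued R" using that loose(5) sv by blast
        \<comment> \<open>If the image is empty, the description denotes an unspecified value and
          the inclusion is trivial.\<close>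
        then have "R `` {e y} \<subseteq> {THE u. (e y, u) \<in> R}"
          by (auto simp: single_valued_def intro!: the_equality[symmetric])
        then show ?thesis by (rule finite_subset) simp
      qed
      then have "finite (\<Union>(y, R)\<in>T. R `` {e y})"
        using loose(4) by auto
      with False have "\<not> U \<inter> S \<subseteq> (\<Union>(y, R)\<in>T. R `` {e y})"
        using finite_subset by blast
      then obtain u where "u \<in> U \<inter> S" "u \<notin> (\<Union>(y, R)\<in>T. R `` {e y})" by blast
      then show ?thesis by (intro bexI[of _ u]) auto
    qed
    with loose(2) show ?thesis unfolding * by simp
  qed
qed

section \<open>Disjunctive normal form\<close>

inductive dnf :: "nat \<Rightarrow> ((nat \<Rightarrow> 'a) \<Rightarrow> bool) \<Rightarrow> bool" for x where
  basic: "basic x P \<Longrightarrow> dnf x P"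
| disj: "dnf x P \<Longrightarrow> dnf x P' \<Longrightarrow> dnf x (\<lambda>e. P e \<or> P' e)"

lemma dnf_conj:
  assumes "dnf x P" "dnf x P'"
  shows "dnf x (\<lambda>e. P e \<and> P' e)"
  using assms(1)
proof induction
  case b: (basic P)
  show ?case
    using assms(2)
    by induction (auto simp: conj_disj_distribL intro: dnf.intros basic_conj b)
next
  case (disj P P1)
  then show ?case by (simp add: conj_disj_distribR dnf.disj)
qed

lemma qf_ex_dnf: "dnf x P \<Longrightarrow> qf (\<lambda>e. \<exists>u\<in>U. P (e(x := u)))"
  by (induction rule: dnf.induct) (simp_all add: qf_ex_basic bex_disj_distrib qf_disj del: fun_upd_apply)

lemma basic_indep: "qf P \<Longrightarrow> (\<And>e u. P (e(x := u)) = P e) \<Longrightarrow> basic x P"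
  using loose[of P x "{}" UNIV] by simp

lemma basic_unary: "qf (\<lambda>e. e x \<in> S) \<Longrightarrow> basic x (\<lambda>e. e x \<in> S)"
  using loose[of "\<lambda>e. True" x "{}" S] qf_const[of True] by simp

lemma basic_pos: "y \<noteq> x \<Longrightarrow> R \<in> \<Q> \<Longrightarrow> basic x (\<lambda>e. (e y, e x) \<in> R)"
  using tied[of y x R "\<lambda>e. True"] qf_const[of True] by simp

lemma basic_neg: "y \<noteq> x \<Longrightarrow> R \<in> \<Q> \<Longrightarrow> basic x (\<lambda>e. (e y, e x) \<notin> R)"
  using loose[of "\<lambda>e. True" x "{(y, R)}" UNIV] qf_const[of True] neg[OF atom] by simp

text \<open>An atom without \<open>x\<close> is a parameter. An atom with \<open>x\<close> on both
  sides restricts \<open>x\<close> to a set that need not come from the family. An atom with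
  \<open>x\<close> on one side is a tie and its negation an exclusion, after passing to
  \<open>R\<inverse>\<close> if \<open>x\<close> is on the left.\<close>

lemma basic_literals:
  assumes "R \<in> \<Q>"
  shows "basic x (\<lambda>e. (e y, e z) \<in> R)" "basic x (\<lambda>e. (e y, e z) \<notin> R)"
proof -
  note a = atom[OF assms, of y z] and n = neg[OF atom[OF assms, of y z]]
  consider "y \<noteq> x" "z \<noteq> x" | "y = x" "z = x" | "y \<noteq> x" "z = x" | "y = x" "z \<noteq> x" by blast
  then have "basic x (\<lambda>e. (e y, e z) \<in> R) \<and> basic x (\<lambda>e. (e y, e z) \<notin> R)"
  proof cases
    case 1
    then show ?thesis using a n by (auto intro!: basic_indep)
  next
    case 2
    then show ?thesis
      using a n basic_unary[of x "{u. (u, u) \<in> R}"] basic_unary[of x "{u. (u, u) \<notin> R}"] by simp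
  next
    case 3
    then show ?thesis using basic_pos basic_neg assms by simp
  next
    case 4
    then show ?thesis using basic_pos[of z x "R\<inverse>"] basic_neg[of z x "R\<inverse>"] inv[OF assms] by simp
  qed
  then show "basic x (\<lambda>e. (e y, e z) \<in> R)" "basic x (\<lambda>e. (e y, e z) \<notin> R)" by simp_all
qed

text \<open>Carrying the negation along in the induction pushes negations down to the atoms.\<close>

lemma qf_dnf: "qf P \<Longrightarrow> dnf x P \<and> dnf x (\<lambda>e. \<not> P e)"
  by (induction rule: qf.induct)
    (simp_all only: de_Morgan_conj not_not dnf.basic basic_literals dnf_conj dnf.disj)

lemma qf_ex: "qf P \<Longrightarrow> qf (\<lambda>e. \<exists>u\<in>U. P (e(x := u)))"
  using qf_dnf qf_ex_dnf by blast

lemma qf_all: "qf P \<Longrightarrow> qf (\<lambda>e. \<forall>u\<in>U. P (e(x := u)))"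
  using neg[OF qf_ex[OF neg]] by simp

section \<open>From formulas to predicates and back\<close>

lemma qf_atom_tm:
  assumes "R \<in> \<Q>" "tm_consts s \<subseteq> U" "tm_consts t \<subseteq> U"
  shows "qf (\<lambda>e. (tm_val e s, tm_val e t) \<in> R)"
  \<comment> \<open>Between two constants the atom has a fixed truth value.\<close>
  using assms by (cases s; cases t) (auto intro: atom qf_atom_const qf_const_atom qf_const)

lemma sat_qf:
  assumes "in_language U \<Q> A"
  shows "\<exists>P. qf P \<and> (\<forall>e. range e \<subseteq> U \<longrightarrow> sat U e A = P e)"
  using assms
proof (induction A)
  case Fls
  then show ?case using qf_const[of False] by auto
next
  case (Eq s t)
  then have c: "tm_consts s \<subseteq> U" "tm_consts t \<subseteq> U" by (auto simp: in_language_def)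
  have "sat U e (Eq s t) \<longleftrightarrow> (tm_val e s, tm_val e t) \<in> Id_on U" if "range e \<subseteq> U" for e
    using that c by (cases s; cases t) (auto simp: Id_on_def)
  then show ?case using qf_atom_tm[OF idU c] by blast
next
  case (Pred R s t)
  then have "qf (\<lambda>e. (tm_val e s, tm_val e t) \<in> R)"
    by (intro qf_atom_tm) (auto simp: in_language_def)
  then show ?case by auto
next
  case (Neg A)
  then obtain P where "qf P" "\<forall>e. range e \<subseteq> U \<longrightarrow> sat U e A = P e"
    by (auto simp: in_language_def)
  then show ?case by (intro exI[of _ "\<lambda>e. \<not> P e"]) (simp add: neg)
next
  case (Conj A B)
  then obtain P P' where "qf P" "\<forall>e. range e \<subseteq> U \<longrightarrow> sat U e A = P e"
    "qf P'" "\<forall>e. range e \<subseteq> U \<longrightarrow> sat U e B = P' e"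
    by (auto simp: in_language_def)
  then show ?case by (intro exI[of _ "\<lambda>e. P e \<and> P' e"]) (simp add: conj)
next
  case (Disj A B)
  then obtain P P' where "qf P" "\<forall>e. range e \<subseteq> U \<longrightarrow> sat U e A = P e"
    "qf P'" "\<forall>e. range e \<subseteq> U \<longrightarrow> sat U e B = P' e"
    by (auto simp: in_language_def)
  then show ?case by (intro exI[of _ "\<lambda>e. P e \<or> P' e"]) (simp add: qf_disj)
next
  case (Imp A B)
  then obtain P P' where "qf P" "\<forall>e. range e \<subseteq> U \<longrightarrow> sat U e A = P e"
    "qf P'" "\<forall>e. range e \<subseteq> U \<longrightarrow> sat U e B = P' e"
    by (auto simp: in_language_def)
  then show ?case by (intro exI[of _ "\<lambda>e. P e \<longrightarrow> P' e"]) (simp add: qf_imp)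
next
  case (Iff A B)
  then obtain P P' where "qf P" "\<forall>e. range e \<subseteq> U \<longrightarrow> sat U e A = P e"
    "qf P'" "\<forall>e. range e \<subseteq> U \<longrightarrow> sat U e B = P' e"
    by (auto simp: in_language_def)
  then show ?case by (intro exI[of _ "\<lambda>e. P e \<longleftrightarrow> P' e"]) (simp add: qf_iff)
next
  case (Ex x A)
  then obtain P where P: "qf P" "\<forall>e. range e \<subseteq> U \<longrightarrow> sat U e A = P e"
    by (auto simp: in_language_def)
  \<comment> \<open>Quantifiers range over \<open>U\<close>, so the updated assignment stays in
    \<open>U\<close> and the induction hypothesis applies to it.\<close>
  have "sat U (e(x := u)) A = P (e(x := u))" if "range e \<subseteq> U" "u \<in> U" for e u
    using that by (intro P(2)[rule_format]) auto
  then show ?case using qf_ex[OF P(1), of x] by (intro exI conjI) auto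
next
  case (All x A)
  then obtain P where P: "qf P" "\<forall>e. range e \<subseteq> U \<longrightarrow> sat U e A = P e"
    by (auto simp: in_language_def)
  have "sat U (e(x := u)) A = P (e(x := u))" if "range e \<subseteq> U" "u \<in> U" for e u
    using that by (intro P(2)[rule_format]) auto
  then show ?case using qf_all[OF P(1), of x] by (intro exI conjI) auto
qed

text \<open>The identity of \<open>U\<close> need not be a predicate symbol of the language; its
  atoms are translated back into equations, which agree with them on assignments into
  \<open>U\<close>.\<close>

lemma qf_sat:
  assumes "qf P" "\<Q> \<subseteq> insert (Id_on U) \<R>"
  shows "\<exists>C. in_language U \<R> C \<and> quantifier_free C \<and> fm_consts C = {} \<and>
    (\<forall>e. range e \<subseteq> U \<longrightarrow> sat U e C = P e)"
  using assms(1)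
proof induction
  case (atom R y z)
  show ?case
  proof (cases "R \<in> \<R>")
    case True
    then show ?thesis by (intro exI[of _ "Pred R (Var y) (Var z)"]) (auto simp: in_language_def)
  next
    case False
    with atom assms(2) have "R = Id_on U" by auto
    then show ?thesis by (intro exI[of _ "Eq (Var y) (Var z)"]) (auto simp: in_language_def image_subset_iff)
  qed
next
  case (neg P)
  then obtain C where "in_language U \<R> C" "quantifier_free C" "fm_consts C = {}"
    "\<forall>e. range e \<subseteq> U \<longrightarrow> sat U e C = P e" by blast
  then show ?case by (intro exI[of _ "Neg C"]) (auto simp: in_language_def)
next
  case (conj P P')
  then obtain C C' where "in_language U \<R> C" "quantifier_free C" "fm_consts C = {}"
    "\<forall>e. range e \<subseteq> U \<longrightarrow> sat U e C = P e"
    "in_language U \<R> C'" "quantifier_free C'" "fm_consts C' = {}"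
    "\<forall>e. range e \<subseteq> U \<longrightarrow> sat U e C' = P' e" by blast
  then show ?case by (intro exI[of _ "Conj C C'"]) (auto simp: in_language_def)
qed

end

theorem theorem7p4:
  fixes U :: "'a set" and \<R> :: "'a rel set"
  assumes "\<And>R. R \<in> \<R> \<Longrightarrow> partial_bijection_on U R"
    and "closed_comp_inv \<R>"
    and "\<And>u. u \<in> U \<Longrightarrow> Id_on {u} \<in> \<R>"
  shows "\<forall>A. in_language U \<R> A \<longrightarrow>
           (\<exists>C. in_language U \<R> C \<and> quantifier_free C \<and> fm_consts C = {} \<and>
                equivalent_in U A C)"
proof (intro allI impI)
  fix A
  assume A: "in_language U \<R> A"
  \<comment> \<open>Adjoining the identity of \<open>U\<close> turns equality into one of the relations.\<close>
  define \<Q> where "\<Q> = insert (Id_on U) \<R>"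
  have sub: "R \<subseteq> U \<times> U" "single_valued R" if "R \<in> \<R>" for R
    using partial_bijection_onD assms(1) that by blast+
  \<comment> \<open>These laws keep the family closed under composition after the identity is
    adjoined.\<close>
  have unit: "R O Id_on U = R" "Id_on U O R = R" if "R \<in> \<R>" for R
    using sub(1)[OF that] by auto
  have closed: "R\<inverse> \<in> \<R>" "R O S \<in> \<R>" if "R \<in> \<R>" "S \<in> \<R>" for R S
    using assms(2) that by (auto simp: closed_comp_inv_def)
  have idid: "Id_on U O Id_on U = Id_on U" by auto
  interpret partial_bijections U \<Q>
  proof
    show "R \<subseteq> U \<times> U" "single_valued R" "R\<inverse> \<in> \<Q>" if "R \<in> \<Q>" for R
      using that sub closed by (auto simp: \<Q>_def single_valued_def)
    show "R O S \<in> \<Q>" if "R \<in> \<Q>" "S \<in> \<Q>" for R S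
      using that unit idid closed by (auto simp: \<Q>_def)
  qed (use assms(3) in \<open>auto simp: \<Q>_def\<close>)
  have "in_language U \<Q> A" using A by (auto simp: in_language_def \<Q>_def)
  then obtain P where P: "qf P" "\<forall>e. range e \<subseteq> U \<longrightarrow> sat U e A = P e"
    using sat_qf by blast
  obtain C where "in_language U \<R> C" "quantifier_free C" "fm_consts C = {}"
    "\<forall>e. range e \<subseteq> U \<longrightarrow> sat U e C = P e"
    using qf_sat[OF P(1), of \<R>] by (auto simp: \<Q>_def)
  then show "\<exists>C. in_language U \<R> C \<and> quantifier_free C \<and> fm_consts C = {} \<and> equivalent_in U A C"
    using P(2) by (auto simp: equivalent_in_def image_subset_iff)
qed

end
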